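(* Let $T\ge r\ge1$ and $m\ge1$ be integers. For every $p\in[1,2]$, $F^*_p(T,r)=\dfrac rm$, and this value is achieved by setting $u_1=\dots=u_m=e_1$, the first standard basis vector of $\mathbb{R}^T$.
   Context: For $u\in\mathbb{R}^T$, $\mathrm{Toep}(u)$ is the $T\times T$ lower-triangular Toeplitz matrix with first column $u$. For inputs $u_1,\dots,u_m\in\mathbb{R}^T$, $\Sigma(u):=\sum_{k=1}^m\mathrm{Toep}(u_k)^{\top}\mathrm{Toep}(u_k)$. For a $T\times T$ matrix $M$, $[M]_{[r]}$ is its upper-left $r\times r$ block. $F^*_p(T,r)$ is the optimal value of the $A$-optimal design problem $$\text{minimize}\ \ \mathrm{Tr}\big([\Sigma(u)^{-1}]_{[r]}\big)\quad\text{over } u_1,\dots,u_m\in\mathbb{R}^T,\ \|u_i\|_p\le1,$$ where the objective is $+\infty$ if $\Sigma(u)$ is not invertible. *)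

theory Defs
  imports
    "HOL-Library.Extended_Real"
    "Jordan_Normal_Form.Gauss_Jordan_Elimination"
    "Jordan_Normal_Form.DL_Submatrix"
begin

definition toep :: "real vec \<Rightarrow> real mat" where
  "toep u = mat (dim_vec u) (dim_vec u) (\<lambda>(i, j). if j \<le> i then u $ (i - j) else 0)"

(* The type of matrices has no zero element common to all dimensions, so the sum over the
   inputs u 1, ..., u m is taken entrywise. *)
definition info_mat :: "nat \<Rightarrow> nat \<Rightarrow> (nat \<Rightarrow> real vec) \<Rightarrow> real mat" where
  "info_mat T m u =
     mat T T (\<lambda>(i, j). \<Sum>k = 1..m. (transpose_mat (toep (u k)) * toep (u k)) $$ (i, j))"

definition tr :: "real mat \<Rightarrow> real" where
  "tr A = (\<Sum>i<dim_row A. A $$ (i, i))"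

definition lp_norm :: "real \<Rightarrow> real vec \<Rightarrow> real" where
  "lp_norm p v = (\<Sum>i<dim_vec v. \<bar>v $ i\<bar> powr p) powr (1 / p)"

definition upper_left :: "nat \<Rightarrow> real mat \<Rightarrow> real mat" where
  "upper_left r A = submatrix A {..<r} {..<r}"

lemma mat_inverse_invertible:
  fixes A :: "real mat"
  assumes "invertible_mat A"
  obtains B where "mat_inverse A = Some B" "inverts_mat A B" "inverts_mat B A"
proof -
  define n where "n = dim_row A"
  from assms have A: "A \<in> carrier_mat n n"
    unfolding n_def invertible_mat_def by auto
  from assms obtain C where C: "inverts_mat A C" "inverts_mat C A"
    unfolding invertible_mat_def by blast
  then have AC: "A * C = 1\<^sub>m n" and CA: "C * A = 1\<^sub>m (dim_row C)"
    using A unfolding inverts_mat_def by auto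
  have "C \<in> carrier_mat n n"
    using arg_cong[OF AC, of dim_col] arg_cong[OF CA, of dim_col] A by auto
  with A AC CA have "A \<in> Units (ring_mat TYPE(real) n ())"
    unfolding Units_def ring_mat_def by auto
  then obtain B where "mat_inverse A = Some B"
    using mat_inverse(1)[OF A, where b = "()"] by (cases "mat_inverse A") auto
  with mat_inverse(2)[OF A this] A show thesis
    by (intro that[of B]) (auto simp: inverts_mat_def)
qed

definition a_opt_objective :: "nat \<Rightarrow> nat \<Rightarrow> nat \<Rightarrow> (nat \<Rightarrow> real vec) \<Rightarrow> ereal" where
  "a_opt_objective T r m u =
     (if invertible_mat (info_mat T m u)
      then ereal (tr (upper_left r (the (mat_inverse (info_mat T m u)))))
      else \<infinity>)"

(* Only the inputs u 1, ..., u m matter; the other values of u are unconstrained and unused. *)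
definition feasible_inputs :: "real \<Rightarrow> nat \<Rightarrow> nat \<Rightarrow> (nat \<Rightarrow> real vec) set" where
  "feasible_inputs p T m = {u. \<forall>k\<in>{1..m}. u k \<in> carrier_vec T \<and> lp_norm p (u k) \<le> 1}"

definition F_opt :: "real \<Rightarrow> nat \<Rightarrow> nat \<Rightarrow> nat \<Rightarrow> ereal" where
  "F_opt p T r m = (INF u\<in>feasible_inputs p T m. a_opt_objective T r m u)"

end

theory Submission
  imports Defs
begin

text \<open>
  Let \<open>S\<close> be the information matrix and \<open>B\<close> its inverse. Nonnegativity of the quadratic form of \<open>S\<close>
  at \<open>B e\<^sub>i - t e\<^sub>i\<close> gives \<open>B\<^sub>i\<^sub>i \<ge> 2 t - t\<^sup>2 S\<^sub>i\<^sub>i\<close>. Each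
  \<open>S\<^sub>i\<^sub>i\<close> is a sum of \<open>m\<close> truncated squared Euclidean norms, and these are at most \<open>1\<close> because
  the Euclidean norm is bounded by the \<open>p\<close>-norm for \<open>p \<le> 2\<close>. With \<open>t = 1/m\<close> every diagonal entry of
  \<open>B\<close> is at least \<open>1/m\<close>. For \<open>u\<^sub>k = e\<^sub>1\<close> the information matrix is \<open>m I\<close>, with equality.
\<close>

text \<open>No single term of the p-norm sum exceeds the whole, so every entry has absolute value at
  most 1. On \<open>[0, 1]\<close> lowering the exponent from 2 to p can only increase the power,
  and squares are dominated termwise.\<close>

lemma sum_squares_le_one_of_lp_norm:
  assumes "1 \<le> p" "p \<le> 2" "lp_norm p v \<le> 1"
  shows "(\<Sum>i<dim_vec v. (v $ i)\<^sup>2) \<le> 1"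
proof -
  define s where "s = (\<Sum>i<dim_vec v. \<bar>v $ i\<bar> powr p)"
  have "s \<le> 1"
  proof (rule ccontr)
    assume "\<not> s \<le> 1"
    then have "1 powr (1 / p) < s powr (1 / p)"
      using assms by (intro powr_less_mono2) auto
    with assms(3) show False by (simp add: lp_norm_def s_def)
  qed
  have "(v $ i)\<^sup>2 \<le> \<bar>v $ i\<bar> powr p" if "i < dim_vec v" for i
  proof -
    have "\<bar>v $ i\<bar> powr p \<le> s"
      unfolding s_def using that by (intro member_le_sum) auto
    with \<open>s \<le> 1\<close> have "\<bar>v $ i\<bar> powr p \<le> 1" by simp
    moreover have "1 powr p < \<bar>v $ i\<bar> powr p" if "1 < \<bar>v $ i\<bar>"
      using assms that by (intro powr_less_mono2) auto
    ultimately have le1: "\<bar>v $ i\<bar> \<le> 1" by force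
    show ?thesis
    \<comment> \<open>\<open>powr_realpow\<close> needs a positive base; at 0 both sides vanish
      since \<open>0 powr p = 0\<close>.\<close>
    proof (cases "v $ i = 0")
      case False
      have "(v $ i)\<^sup>2 = \<bar>v $ i\<bar> powr 2"
        using False powr_realpow[of "\<bar>v $ i\<bar>" 2] by simp
      also have "\<dots> \<le> \<bar>v $ i\<bar> powr p"
        using assms le1 False by (intro powr_mono') auto
      finally show ?thesis .
    qed simp
  qed
  then have "(\<Sum>i<dim_vec v. (v $ i)\<^sup>2) \<le> s"
    unfolding s_def by (intro sum_mono) auto
  with \<open>s \<le> 1\<close> show ?thesis by simp
qed

lemma toep_carrier [simp]: "u \<in> carrier_vec T \<Longrightarrow> toep u \<in> carrier_mat T T"
  by (auto simp: toep_def)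

lemma toep_index:
  "u \<in> carrier_vec T \<Longrightarrow> i < T \<Longrightarrow> j < T \<Longrightarrow> toep u $$ (i, j) = (if j \<le> i then u $ (i - j) else 0)"
  by (auto simp: toep_def)

lemma info_mat_carrier [simp]: "info_mat T m u \<in> carrier_mat T T"
  by (simp add: info_mat_def)

lemma info_mat_dim [simp]: "dim_row (info_mat T m u) = T" "dim_col (info_mat T m u) = T"
  by (simp_all add: info_mat_def)

lemma info_mat_index:
  assumes "\<forall>k\<in>{1..m}. u k \<in> carrier_vec T" "i < T" "j < T"
  shows "info_mat T m u $$ (i, j) = (\<Sum>k=1..m. \<Sum>l<T. toep (u k) $$ (l, i) * toep (u k) $$ (l, j))"
proof -
  have "(transpose_mat (toep (u k)) * toep (u k)) $$ (i, j)
      = (\<Sum>l<T. toep (u k) $$ (l, i) * toep (u k) $$ (l, j))" if "k \<in> {1..m}" for k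
  proof -
    have "toep (u k) \<in> carrier_mat T T" using assms that by simp
    then show ?thesis
      using assms by (auto simp: scalar_prod_def lessThan_atLeast0 intro!: sum.cong)
  qed
  then show ?thesis using assms by (simp add: info_mat_def)
qed

lemma info_mat_symmetric:
  assumes "\<forall>k\<in>{1..m}. u k \<in> carrier_vec T"
  shows "transpose_mat (info_mat T m u) = info_mat T m u"
  using assms
  by (intro eq_matI) (auto simp: info_mat_index mult.commute)

text \<open>The form is a Gram form: it equals the sum over k of the squared Euclidean norms of
  \<open>toep (u k) *\<^sub>v x\<close>.\<close>

lemma info_mat_psd:
  assumes u: "\<forall>k\<in>{1..m}. u k \<in> carrier_vec T" and x: "x \<in> carrier_vec T"
  shows "0 \<le> x \<bullet> (info_mat T m u *\<^sub>v x)"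
proof -
  let ?A = "\<lambda>k l i. toep (u k) $$ (l, i)"
  \<comment> \<open>All three index sets coincide, so rewriting with \<open>sum.swap\<close> would
    loop. The sum over k has a different index set and can be moved outward by directed
    rewriting.\<close>
  have swap: "(\<Sum>i<T. \<Sum>j<T. \<Sum>l<T. g i j l) = (\<Sum>l<T. \<Sum>i<T. \<Sum>j<T. g i j l)"
    for g :: "nat \<Rightarrow> nat \<Rightarrow> nat \<Rightarrow> real"
    by (rule trans[OF sum.cong[OF refl sum.swap] sum.swap])
  have "x \<bullet> (info_mat T m u *\<^sub>v x) = (\<Sum>i<T. x $ i * (\<Sum>j<T. info_mat T m u $$ (i, j) * x $ j))"
    using x
    by (auto simp: scalar_prod_def lessThan_atLeast0 intro!: sum.cong)
  also have "\<dots> = (\<Sum>i<T. \<Sum>j<T. \<Sum>k=1..m. \<Sum>l<T. (?A k l i * x $ i) * (?A k l j * x $ j))"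
    using u by (auto simp: info_mat_index sum_distrib_left sum_distrib_right mult_ac intro!: sum.cong)
  also have "\<dots> = (\<Sum>k=1..m. \<Sum>i<T. \<Sum>j<T. \<Sum>l<T. (?A k l i * x $ i) * (?A k l j * x $ j))"
    by (simp only: sum.swap[where A = "{..<T}" and B = "{1..m}"])
  also have "\<dots> = (\<Sum>k=1..m. \<Sum>l<T. \<Sum>i<T. \<Sum>j<T. (?A k l i * x $ i) * (?A k l j * x $ j))"
    by (rule sum.cong[OF refl swap])
  also have "\<dots> = (\<Sum>k=1..m. \<Sum>l<T. (\<Sum>i<T. ?A k l i * x $ i)\<^sup>2)"
    by (simp add: power2_eq_square sum_product)
  finally show ?thesis by (simp add: sum_nonneg)
qed

text \<open>Column i of \<open>toep (u k)\<close> is \<open>u k\<close> shifted down by i and cut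
  off at T, so its squared norm is a partial sum of that of \<open>u k\<close>.\<close>

lemma info_mat_diag_le:
  assumes "\<forall>k\<in>{1..m}. u k \<in> carrier_vec T" "\<And>k. k \<in> {1..m} \<Longrightarrow> (\<Sum>i<T. (u k $ i)\<^sup>2) \<le> 1" "i < T"
  shows "info_mat T m u $$ (i, i) \<le> real m"
proof -
  have "(\<Sum>l<T. toep (u k) $$ (l, i) * toep (u k) $$ (l, i)) \<le> 1" if k: "k \<in> {1..m}" for k
  proof -
    have "u k \<in> carrier_vec T" using assms k by blast
    then have "(\<Sum>l<T. toep (u k) $$ (l, i) * toep (u k) $$ (l, i))
        = (\<Sum>l\<in>{i..<T}. (u k $ (l - i))\<^sup>2)"
      using assms(3)
      by (intro sum.mono_neutral_cong_right) (auto simp: toep_index[of _ T] power2_eq_square)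
    also have "\<dots> = (\<Sum>l\<in>(\<lambda>l. l - i) ` {i..<T}. (u k $ l)\<^sup>2)"
      by (subst sum.reindex) (auto simp: inj_on_def)
    also have "\<dots> \<le> (\<Sum>l<T. (u k $ l)\<^sup>2)"
      by (intro sum_mono2) auto
    also have "\<dots> \<le> 1" using assms k by blast
    finally show ?thesis .
  qed
  then have "(\<Sum>k=1..m. \<Sum>l<T. toep (u k) $$ (l, i) * toep (u k) $$ (l, i)) \<le> (\<Sum>k=1..m. 1)"
    by (intro sum_mono) auto
  then show ?thesis using assms by (simp add: info_mat_index)
qed

text \<open>For positive \<open>S $$ (i, i)\<close>, taking t as its reciprocal gives the familiar
  bound of \<open>B $$ (i, i)\<close> below by that reciprocal. A free t keeps the bound linear in
  \<open>S $$ (i, i)\<close>, ready for an upper estimate of that entry.\<close>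

lemma psd_inverse_diag_ge:
  fixes S B :: "real mat"
  assumes S: "S \<in> carrier_mat n n" and B: "B \<in> carrier_mat n n"
    and sym: "transpose_mat S = S" and psd: "\<And>x. x \<in> carrier_vec n \<Longrightarrow> 0 \<le> x \<bullet> (S *\<^sub>v x)"
    and SB: "S * B = 1\<^sub>m n" and i: "i < n"
  shows "2 * t - t\<^sup>2 * S $$ (i, i) \<le> B $$ (i, i)"
proof -
  let ?b = "col B i" and ?e = "unit_vec n i :: real vec"
  let ?x = "?b - t \<cdot>\<^sub>v ?e"
  have b: "?b \<in> carrier_vec n" and Se: "col S i \<in> carrier_vec n" using B S by auto
  have Sb: "S *\<^sub>v ?b = ?e"
    using arg_cong[OF SB, of "\<lambda>M. col M i"] S B i by (simp add: col_mult2[OF S B i])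
  have "S *\<^sub>v ?e = col S i"
    using S i by (intro eq_vecI) auto
  then have "S *\<^sub>v ?x = ?e - t \<cdot>\<^sub>v col S i"
    using S b Sb by (simp add: mult_minus_distrib_mat_vec mult_mat_vec)
  moreover have "?e - t \<cdot>\<^sub>v col S i \<in> carrier_vec n" using Se by simp
  ultimately have "?x \<bullet> (S *\<^sub>v ?x) = ?b \<bullet> ?e - t * (?b \<bullet> col S i) - t * (?e \<bullet> ?e - t * (?e \<bullet> col S i))"
    using S b Se by (simp add: algebra_simps minus_scalar_prod_distrib[of _ n] scalar_prod_minus_distrib[of _ n])
  \<comment> \<open>Symmetry turns this cross term into entry i of \<open>S *\<^sub>v ?b\<close>,
    which is the unit vector.\<close>
  moreover have "?b \<bullet> col S i = 1"
  proof -
    have "col S i = row S i" using sym S i by (metis carrier_matD(2) row_transpose)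
    then have "?b \<bullet> col S i = row S i \<bullet> ?b" using b Se by (metis comm_scalar_prod)
    also have "\<dots> = (S *\<^sub>v ?b) $ i" using S i by simp
    finally show ?thesis using Sb i by simp
  qed
  ultimately have "?x \<bullet> (S *\<^sub>v ?x) = B $$ (i, i) - 2 * t + t\<^sup>2 * S $$ (i, i)"
    using S B b Se i by (simp add: algebra_simps power2_eq_square)
  moreover have "?x \<in> carrier_vec n" using b by simp
  ultimately show ?thesis using psd[of ?x] by simp
qed

text \<open>\<open>submatrix\<close> addresses its entries through \<open>pick\<close>; an initial
  segment has exactly i elements below i, so no renumbering occurs.\<close>

lemma pick_lessThan:
  assumes "i < r"
  shows "pick {..<r} i = i"
proof -
  have "{a \<in> {..<r}. a < i} = {..<i}" using assms by auto
  then show ?thesis using pick_card_in_set[of i "{..<r}"] assms by simp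
qed

lemma tr_upper_left:
  assumes "A \<in> carrier_mat n n" "r \<le> n"
  shows "tr (upper_left r A) = (\<Sum>i<r. A $$ (i, i))"
proof -
  have c: "card {i. i < n \<and> i < r} = r"
    using assms by (simp add: Collect_conj_eq lessThan_def[symmetric] Int_absorb1)
  then show ?thesis
    using assms unfolding tr_def upper_left_def
    by (auto simp: dim_submatrix submatrix_index pick_lessThan intro!: sum.cong)
qed

text \<open>By uniqueness of inverses, the result of \<open>mat_inverse\<close> can be replaced by
  any explicit two-sided inverse.\<close>

lemma a_opt_objective_eq:
  assumes "info_mat T m u * B = 1\<^sub>m T" "B * info_mat T m u = 1\<^sub>m T" "B \<in> carrier_mat T T" "r \<le> T"
  shows "a_opt_objective T r m u = ereal (\<Sum>i<r. B $$ (i, i))"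
proof -
  let ?S = "info_mat T m u"
  have S: "?S \<in> carrier_mat T T" by simp
  have "invertible_mat ?S"
    using assms unfolding invertible_mat_def inverts_mat_def by (auto intro!: exI[of _ B])
  then obtain C where C: "mat_inverse ?S = Some C" "inverts_mat ?S C"
    by (rule mat_inverse_invertible)
  have Cc: "C \<in> carrier_mat T T" using mat_inverse(2)[OF S C(1)] by simp
  have "C = (B * ?S) * C" using assms Cc by simp
  also have "\<dots> = B * (?S * C)" by (rule assoc_mult_mat[OF assms(3) S Cc])
  also have "\<dots> = B" using C assms S by (auto simp: inverts_mat_def)
  finally show ?thesis
    using C \<open>invertible_mat ?S\<close> assms by (simp add: a_opt_objective_def tr_upper_left)
qed

lemma a_opt_objective_ge:
  assumes "r \<le> T" "1 \<le> m" "1 \<le> p" "p \<le> 2" and u: "u \<in> feasible_inputs p T m"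
  shows "ereal (real r / real m) \<le> a_opt_objective T r m u"
proof (cases "invertible_mat (info_mat T m u)")
  case True
  let ?S = "info_mat T m u"
  obtain B where B: "mat_inverse ?S = Some B"
    using True by (rule mat_inverse_invertible)
  note inv = mat_inverse(2)[OF info_mat_carrier B]
  have uc: "\<forall>k\<in>{1..m}. u k \<in> carrier_vec T" using u by (simp add: feasible_inputs_def)
  have norm: "(\<Sum>i<T. (u k $ i)\<^sup>2) \<le> 1" if "k \<in> {1..m}" for k
    using sum_squares_le_one_of_lp_norm[of p "u k"] u assms that
    by (auto simp: feasible_inputs_def dest!: bspec[of _ _ k])
  have "1 / real m \<le> B $$ (i, i)" if "i < r" for i
  proof -
    have i: "i < T" using that assms by simp
    \<comment> \<open>\<open>t = 1 / m\<close> maximises \<open>2 * t - t\<^sup>2 * m\<close>, so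
      nothing is lost when the diagonal entry equals m.\<close>
    have "1 / real m = 2 * (1 / real m) - (1 / real m)\<^sup>2 * real m"
      using assms by (simp add: power2_eq_square)
    also have "\<dots> \<le> 2 * (1 / real m) - (1 / real m)\<^sup>2 * ?S $$ (i, i)"
      by (intro diff_left_mono mult_left_mono info_mat_diag_le uc norm i) auto
    also have "\<dots> \<le> B $$ (i, i)"
      using inv uc i
      by (intro psd_inverse_diag_ge[of _ T] info_mat_symmetric info_mat_psd) auto
    finally show ?thesis .
  qed
  then have "(\<Sum>i<r. 1 / real m) \<le> (\<Sum>i<r. B $$ (i, i))"
    by (intro sum_mono) auto
  then show ?thesis
    using inv assms by (simp add: a_opt_objective_eq[of T m u B])
qed (simp add: a_opt_objective_def)

lemma unit_vec_feasible:
  assumes "1 \<le> p"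
  shows "(\<lambda>k. unit_vec T 0) \<in> feasible_inputs p T m"
proof -
  have "(\<Sum>i<T. \<bar>unit_vec T 0 $ i\<bar> powr p) = (\<Sum>i<T. if i = 0 then 1 else 0 :: real)"
    by (intro sum.cong) auto
  \<comment> \<open>Index 0 is the first coordinate, so this is the vector \<open>e_1\<close>. The
    sum is 1 for positive T and 0 for \<open>T = 0\<close>.\<close>
  also have "\<dots> \<le> 1" by simp
  finally have "(\<Sum>i<T. \<bar>unit_vec T 0 $ i\<bar> powr p) powr (1 / p) \<le> 1"
    using assms by (intro powr_le1) (simp_all add: sum_nonneg abs_of_nonneg)
  then show ?thesis by (auto simp: feasible_inputs_def lp_norm_def)
qed

lemma toep_unit_vec: "toep (unit_vec T 0) = 1\<^sub>m T"
  by (intro eq_matI) (auto simp: toep_def)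

lemma a_opt_objective_unit_vec:
  assumes "r \<le> T" "1 \<le> m"
  shows "a_opt_objective T r m (\<lambda>k. unit_vec T 0) = ereal (real r / real m)"
proof -
  have S: "info_mat T m (\<lambda>k. unit_vec T 0) = real m \<cdot>\<^sub>m 1\<^sub>m T"
    by (intro eq_matI) (auto simp: info_mat_def toep_unit_vec)
  have "a_opt_objective T r m (\<lambda>k. unit_vec T 0)
      = ereal (\<Sum>i<r. ((1 / real m) \<cdot>\<^sub>m 1\<^sub>m T) $$ (i, i))"
    using assms unfolding S
    by (intro a_opt_objective_eq) (auto simp: S intro!: eq_matI)
  also have "(\<Sum>i<r. ((1 / real m) \<cdot>\<^sub>m 1\<^sub>m T) $$ (i, i)) = (\<Sum>i<r. 1 / real m)"
    using assms by (intro sum.cong) auto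
  finally show ?thesis by simp
qed

theorem lemma3p6:
  fixes T r m :: nat and p :: real
  assumes "1 \<le> r" and "r \<le> T" and "1 \<le> m"
    and "1 \<le> p" and "p \<le> 2"
  shows "F_opt p T r m = ereal (real r / real m)
    \<and> (\<lambda>k. unit_vec T 0) \<in> feasible_inputs p T m
    \<and> a_opt_objective T r m (\<lambda>k. unit_vec T 0) = F_opt p T r m"
proof -
  note feas = unit_vec_feasible[OF assms(4), of T m]
  note val = a_opt_objective_unit_vec[OF assms(2,3)]
  have "F_opt p T r m = ereal (real r / real m)"
    unfolding F_opt_def
  proof (rule antisym)
    \<comment> \<open>The feasible unit-vector input caps the infimum, which is therefore
      attained.\<close>
    show "(INF u\<in>feasible_inputs p T m. a_opt_objective T r m u) \<le> ereal (real r / real m)"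
      using INF_lower[OF feas, of "a_opt_objective T r m"] val by simp
    show "ereal (real r / real m) \<le> (INF u\<in>feasible_inputs p T m. a_opt_objective T r m u)"
      using assms by (intro INF_greatest a_opt_objective_ge)
  qed
  with feas val show ?thesis by simp
qed

end
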